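(* Let $k\ge 2$ and $G=(V,E)$ be an arbitrary graph. Then \[ \sum_{n_1,\ldots,n_k=1}^{\infty} \frac{\delta_G(n_1,\ldots,n_k)}{n_1^{s_1}\cdots n_k^{s_k}} =\zeta(s_1)\cdots \zeta(s_k)\, D'_G(s_1,\ldots,s_k), \] where \begin{align*} D'_G(s_1,\ldots,s_k) & = \prod_p \Bigg( \sum_{\substack{L\subseteq J\\ L \text{ independent}}} \prod_{\ell \in L} \frac1{p^{s_{\ell}}} \prod_{i\in (J\setminus L) \cup (N(L)\setminus J)} \left(1-\frac1{p^{s_i}}\right)\Bigg) \\ & = \prod_p \Bigg(1 - \sum_{\{i,j\}\in E} \frac1{p^{s_i+s_j}} + \sum_{j=3}^{|I|} \sum_{\substack{i_1,\ldots,i_j\in I\\ i_1<\cdots <i_j}} \frac{c(i_1,\ldots,i_j)}{p^{s_{i_1}+\cdots +s_{i_j}}}\Bigg), \end{align*} where $c(i_1,\ldots,i_j)$ are some integers, depending on $i_1,\ldots,i_j$, but not on $p$. Furthermore, $D'_G(s_1,\ldots,s_k)$ with $s_1,\ldots,s_k\in\mathbb{C}$ is absolutely convergent provided that $\Re (s_{i_1}+\cdots +s_{i_j})>1$ for every $i_1,\ldots,i_j\in I$ with $i_1< \cdots < i_j$, $2\le j\le |I|$.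
   Context: Let $V=\{1,\ldots,k\}$ and $E\subseteq\{\{i,j\}:1\le i<j\le k\}$, giving the simple graph $G=(V,E)$. $\delta_G(n_1,\ldots,n_k)=1$ if $\gcd(n_i,n_j)=1$ for every $\{i,j\}\in E$ and $0$ otherwise. $I$ is the set of non-isolated vertices of $G$; $J$ is a (minimum) vertex cover of $G$, i.e. a set of vertices containing at least one endpoint of every edge. The sum over $L$ runs over the independent subsets $L$ of $J$ (no two vertices of $L$ adjacent in $G$). $N(j)$ denotes the neighbourhood of a vertex $j$, and $N(L)=\bigcup_{j\in L}N(j)$. $\zeta$ is the Riemann zeta function; products over $p$ are over primes. *)

theory Defs
  imports "HOL-Analysis.Analysis" "HOL-Computational_Algebra.Primes"
begin

text \<open>
  A simple graph on \<open>{1..k}\<close> is given by its set of edges, each edge being a two-element set.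
\<close>

definition simple_graph :: "nat \<Rightarrow> nat set set \<Rightarrow> bool" where
  "simple_graph k E \<longleftrightarrow> E \<subseteq> {{i, j} |i j. 1 \<le> i \<and> i < j \<and> j \<le> k}"

definition non_isolated :: "nat \<Rightarrow> nat set set \<Rightarrow> nat set" where
  "non_isolated k E = {i \<in> {1..k}. \<exists>j. {i, j} \<in> E}"

definition vertex_cover :: "nat \<Rightarrow> nat set set \<Rightarrow> nat set \<Rightarrow> bool" where
  "vertex_cover k E J \<longleftrightarrow> J \<subseteq> {1..k} \<and> (\<forall>e\<in>E. e \<inter> J \<noteq> {})"

definition independent_set :: "nat set set \<Rightarrow> nat set \<Rightarrow> bool" where
  "independent_set E L \<longleftrightarrow> (\<forall>i\<in>L. \<forall>j\<in>L. {i, j} \<notin> E)"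

definition nbhd :: "nat set set \<Rightarrow> nat \<Rightarrow> nat set" where
  "nbhd E j = {i. {i, j} \<in> E}"

definition nbhd_set :: "nat set set \<Rightarrow> nat set \<Rightarrow> nat set" where
  "nbhd_set E L = (\<Union>j\<in>L. nbhd E j)"

definition delta :: "nat set set \<Rightarrow> (nat \<Rightarrow> nat) \<Rightarrow> complex" where
  "delta E n = (if \<forall>i j. {i, j} \<in> E \<longrightarrow> gcd (n i) (n j) = 1 then 1 else 0)"

text \<open>
  The Riemann zeta function by its Dirichlet series; meaningful only for \<open>Re s > 1\<close>.
\<close>

definition zeta :: "complex \<Rightarrow> complex" where
  "zeta s = (\<Sum>n. 1 / of_nat (Suc n) powr s)"

text \<open>
  Infinite products over the primes, as products over the natural numbers in which
  every non-prime index contributes the factor 1.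
\<close>

definition euler_prod :: "(nat \<Rightarrow> complex) \<Rightarrow> complex" where
  "euler_prod f = (\<Prod>p. if prime p then f p else 1)"

definition abs_convergent_euler_prod :: "(nat \<Rightarrow> complex) \<Rightarrow> bool" where
  "abs_convergent_euler_prod f \<longleftrightarrow> abs_convergent_prod (\<lambda>p. if prime p then f p else 1)"

definition cover_factor ::
    "nat set set \<Rightarrow> nat set \<Rightarrow> (nat \<Rightarrow> complex) \<Rightarrow> nat \<Rightarrow> complex" where
  "cover_factor E J s p =
     (\<Sum>L | L \<subseteq> J \<and> independent_set E L.
        (\<Prod>l\<in>L. 1 / of_nat p powr s l) *
        (\<Prod>i\<in>(J - L) \<union> (nbhd_set E L - J). 1 - 1 / of_nat p powr s i))"

text \<open>
  Increasing tuples \<open>i\<^sub>1 < \<dots> < i\<^sub>j\<close> in \<open>I\<close> are represented by the \<open>j\<close>-element subsets of \<open>I\<close>.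
\<close>

definition expanded_factor ::
    "nat \<Rightarrow> nat set set \<Rightarrow> (nat set \<Rightarrow> int) \<Rightarrow> (nat \<Rightarrow> complex) \<Rightarrow> nat \<Rightarrow> complex" where
  "expanded_factor k E c s p =
     1 - (\<Sum>e\<in>E. 1 / of_nat p powr (\<Sum>i\<in>e. s i))
       + (\<Sum>j = 3..card (non_isolated k E).
            \<Sum>S | S \<subseteq> non_isolated k E \<and> card S = j.
              of_int (c S) / of_nat p powr (\<Sum>i\<in>S. s i))"

definition D' :: "nat set set \<Rightarrow> nat set \<Rightarrow> (nat \<Rightarrow> complex) \<Rightarrow> complex" where
  "D' E J s = euler_prod (cover_factor E J s)"

end

theory Submission
  imports Defs
begin

text \<open>
  For a prime \<open>p\<close> put \<open>x\<^sub>i = p\<close> to the power \<open>-s\<^sub>i\<close> and think of \<open>x\<^sub>i\<close> as the probability that \<open>p\<close> divides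
  \<open>n\<^sub>i\<close>, independently for all \<open>i\<close>. Then \<open>cover_factor\<close> is the probability that
  \<open>A = {i. p dvd n\<^sub>i}\<close> is an independent set, computed by conditioning on \<open>L = A \<inter> J\<close>: as the complement
  of \<open>J\<close> is independent, the only further constraint is that \<open>A\<close> avoids \<open>N(L) - J\<close>.
  Expanding the products gives a multilinear polynomial in the \<open>x\<^sub>i\<close> with coefficients \<open>c(S)\<close>, which are
  the Moebius inverse of the indicator of independence. They vanish on singletons and whenever \<open>S\<close>
  contains an isolated vertex, and equal minus the indicator of \<open>E\<close> on pairs.

  For the Dirichlet series, \<open>\<delta>\<^sub>G(n) = 1\<close> iff \<open>{i. p dvd n\<^sub>i}\<close> is independent for every prime \<open>p\<close>.
  Imposing this only for the primes up to \<open>N\<close>, Moebius inversion at each prime yields the product of the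
  zeta values and the Euler product truncated at \<open>N\<close>; dominated convergence gives the limit.
\<close>

subsection \<open>Independent sets\<close>

text \<open>Moebius inversion over the subset lattice. The value depends on \<open>E\<close> and
  \<open>S\<close> alone, so it can serve as \<open>c\<close> for all \<open>s\<close> and all
  primes.\<close>

definition indep_coeff :: "nat set set \<Rightarrow> nat set \<Rightarrow> int" where
  "indep_coeff E S = (\<Sum>A | A \<subseteq> S \<and> independent_set E A. (-1) ^ card (S - A))"

text \<open>Each product of the \<open>1 - x i\<close> expands into signed monomials over
  \<open>T \<subseteq> V - A\<close>; collecting the pairs with \<open>A \<union> T = S\<close>
  leaves \<open>indep_coeff E S\<close>. A general ring allows evaluation at \<open>x = 1\<close> as
  well as at prime powers.\<close>

lemma sum_independent_eq_sum_indep_coeff: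
  fixes x :: "nat \<Rightarrow> 'a :: comm_ring_1"
  assumes "finite V"
  shows "(\<Sum>A | A \<subseteq> V \<and> independent_set E A. (\<Prod>i\<in>A. x i) * (\<Prod>i\<in>V - A. 1 - x i)) =
         (\<Sum>S\<in>Pow V. of_int (indep_coeff E S) * (\<Prod>i\<in>S. x i))"
proof -
  let ?I = "{A. A \<subseteq> V \<and> independent_set E A}"
  have fI: "finite ?I" using assms by simp
  have "(\<Sum>A\<in>?I. (\<Prod>i\<in>A. x i) * (\<Prod>i\<in>V - A. 1 - x i)) =
        (\<Sum>A\<in>?I. \<Sum>T\<in>Pow (V - A). (- 1) ^ card T * (\<Prod>i\<in>A \<union> T. x i))"
  proof (rule sum.cong[OF refl])
    fix A assume A: "A \<in> ?I"
    have "(\<Prod>i\<in>V - A. 1 - x i) = (\<Prod>i\<in>V - A. - x i + 1)"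
      by simp
    also have "\<dots> = (\<Sum>T\<in>Pow (V - A). \<Prod>i\<in>T. - x i)"
      using assms by (subst prod_add) auto
    finally have "(\<Prod>i\<in>A. x i) * (\<Prod>i\<in>V - A. 1 - x i) =
        (\<Sum>T\<in>Pow (V - A). (\<Prod>i\<in>A. x i) * (\<Prod>i\<in>T. - x i))"
      by (simp add: sum_distrib_left)
    also have "\<dots> = (\<Sum>T\<in>Pow (V - A). (- 1) ^ card T * (\<Prod>i\<in>A \<union> T. x i))"
    proof (rule sum.cong[OF refl])
      fix T assume T: "T \<in> Pow (V - A)"
      have "finite A" "finite T" "A \<inter> T = {}"
        using A T assms by (auto dest: finite_subset)
      then show "(\<Prod>i\<in>A. x i) * (\<Prod>i\<in>T. - x i) = (- 1) ^ card T * (\<Prod>i\<in>A \<union> T. x i)"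
        by (simp add: prod.union_disjoint prod_uminus mult_ac)
    qed
    finally show "(\<Prod>i\<in>A. x i) * (\<Prod>i\<in>V - A. 1 - x i) =
        (\<Sum>T\<in>Pow (V - A). (- 1) ^ card T * (\<Prod>i\<in>A \<union> T. x i))" .
  qed
  also have "\<dots> = (\<Sum>(A, T)\<in>Sigma ?I (\<lambda>A. Pow (V - A)). (- 1) ^ card T * (\<Prod>i\<in>A \<union> T. x i))"
    using fI assms by (subst sum.Sigma) auto
  also have "\<dots> = (\<Sum>(S, A)\<in>Sigma (Pow V) (\<lambda>S. {A. A \<subseteq> S \<and> independent_set E A}).
                     (- 1) ^ card (S - A) * (\<Prod>i\<in>S. x i))"
  \<comment> \<open>As \<open>A\<close> and \<open>T\<close> are disjoint, \<open>T\<close> is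
    recovered from the union \<open>S\<close> as \<open>S - A\<close>.\<close>
  proof (rule sum.reindex_bij_witness[of _ "\<lambda>(S, A). (A, S - A)" "\<lambda>(A, T). (A \<union> T, A)"])
    fix b assume "b \<in> Sigma (Pow V) (\<lambda>S. {A. A \<subseteq> S \<and> independent_set E A})"
    then show "(\<lambda>(A, T). (A \<union> T, A)) ((\<lambda>(S, A). (A, S - A)) b) = b"
      by auto
  next
    fix a assume a: "a \<in> Sigma ?I (\<lambda>A. Pow (V - A))"
    obtain A T where aa: "a = (A, T)" by force
    have "A \<union> T - A = T" using a aa by auto
    then show "(\<lambda>(S, A). (A, S - A)) ((\<lambda>(A, T). (A \<union> T, A)) a) = a"
      "(case (\<lambda>(A, T). (A \<union> T, A)) a of (S, A) \<Rightarrow> (- 1) ^ card (S - A) * (\<Prod>i\<in>S. x i)) =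
         (case a of (A, T) \<Rightarrow> (- 1) ^ card T * (\<Prod>i\<in>A \<union> T. x i))"
      using aa by auto
  qed auto
  also have "\<dots> = (\<Sum>S\<in>Pow V. \<Sum>A | A \<subseteq> S \<and> independent_set E A.
                     (- 1) ^ card (S - A) * (\<Prod>i\<in>S. x i))"
    using assms
    by (subst sum.Sigma) (auto intro!: finite_subset[of "Collect _" "Pow V"])
  also have "\<dots> = (\<Sum>S\<in>Pow V. of_int (indep_coeff E S) * (\<Prod>i\<in>S. x i))"
    by (simp add: indep_coeff_def sum_distrib_right)
  finally show ?thesis .
qed

text \<open>This is the polynomial identity at \<open>x = 1\<close>: every term with
  \<open>B \<noteq> A\<close> contains a factor 0, and \<open>B = A\<close> leaves an empty
  product.\<close>

lemma sum_indep_coeff: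
  assumes "finite A"
  shows "(\<Sum>S\<in>Pow A. of_int (indep_coeff E S)) = (of_bool (independent_set E A) :: 'a :: comm_ring_1)"
proof -
  have "(\<Sum>S\<in>Pow A. of_int (indep_coeff E S)) =
        (\<Sum>B | B \<subseteq> A \<and> independent_set E B. \<Prod>i\<in>A - B. 0 :: 'a)"
    using sum_independent_eq_sum_indep_coeff[OF assms, of "\<lambda>_. 1 :: 'a" E] by simp
  also have "\<dots> = (\<Sum>B | B \<subseteq> A \<and> independent_set E B. if B = A then 1 else 0)"
    using assms by (intro sum.cong) (auto simp: power_0_left finite_subset)
  also have "\<dots> = of_bool (independent_set E A)"
    using assms by (subst sum.delta) auto
  finally show ?thesis .
qed

lemma indep_coeff_empty: "indep_coeff E {} = 1"
  using sum_indep_coeff[of "{}" E, where 'a = int] by (simp add: independent_set_def)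

lemma indep_coeff_singleton:
  assumes "{i} \<notin> E"
  shows "indep_coeff E {i} = 0"
  using sum_indep_coeff[of "{i}" E, where 'a = int] assms
  by (simp add: independent_set_def Pow_insert indep_coeff_empty)

text \<open>In \<open>sum_indep_coeff\<close> for the pair, the empty set contributes 1 and the
  singletons 0, which determines the remaining coefficient.\<close>

lemma indep_coeff_pair:
  assumes "{i} \<notin> E" "{j} \<notin> E" "i \<noteq> j"
  shows "indep_coeff E {i, j} = - of_bool ({i, j} \<in> E)"
proof -
  have "Pow {i, j} = {{}, {i}, {j}, {i, j}}" by auto
  moreover have "independent_set E {i, j} \<longleftrightarrow> {i, j} \<notin> E"
    using assms by (auto simp: independent_set_def insert_commute)
  ultimately show ?thesis
    using sum_indep_coeff[of "{i, j}" E, where 'a = int] assms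
    by (auto simp: indep_coeff_empty indep_coeff_singleton doubleton_eq_iff)
qed

text \<open>Adding \<open>v\<close> to a set preserves independence in both directions but flips the
  sign, so the terms for \<open>A\<close> and \<open>insert v A\<close> cancel.\<close>

lemma indep_coeff_isolated:
  assumes "finite S" "v \<in> S" and iso: "\<And>i. {v, i} \<notin> E"
  shows "indep_coeff E S = 0"
proof -
  define T where "T = S - {v}"
  have S: "S = insert v T" "v \<notin> T" "finite T" using assms by (auto simp: T_def)
  have ind: "independent_set E (insert v A) \<longleftrightarrow> independent_set E A" for A
    using iso by (auto simp: independent_set_def insert_commute)
  let ?I = "{A. A \<subseteq> T \<and> independent_set E A}"
  have fin: "finite ?I" using S by simp
  have *: "{A. A \<subseteq> S \<and> independent_set E A} = ?I \<union> insert v ` ?I"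
  proof (intro equalityI subsetI)
    fix A assume "A \<in> {A. A \<subseteq> S \<and> independent_set E A}"
    then have A: "A \<subseteq> insert v T" "independent_set E A" using S by auto
    show "A \<in> ?I \<union> insert v ` ?I"
    proof (cases "v \<in> A")
      case True
      then have "A = insert v (A - {v})" "A - {v} \<subseteq> T" using A by auto
      moreover have "independent_set E (A - {v})" using A by (auto simp: independent_set_def)
      ultimately show ?thesis by blast
    qed (use A in auto)
  qed (use S ind in auto)
  have "indep_coeff E S = (\<Sum>A\<in>?I. (-1) ^ card (S - A)) + (\<Sum>A\<in>insert v ` ?I. (-1) ^ card (S - A))"
    unfolding indep_coeff_def * using S fin by (intro sum.union_disjoint) auto
  also have "(\<Sum>A\<in>insert v ` ?I. (-1) ^ card (S - A)) = (\<Sum>A\<in>?I. ((-1) ^ card (S - insert v A) :: int))"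
    using S by (subst sum.reindex) (auto intro!: inj_onI)
  also have "(\<Sum>A\<in>?I. (-1) ^ card (S - A)) = (\<Sum>A\<in>?I. - ((-1) ^ card (S - insert v A) :: int))"
  proof (rule sum.cong[OF refl])
    fix A assume A: "A \<in> ?I"
    have "S - A = insert v (T - A)" "S - insert v A = T - A" "v \<notin> T - A" using A S by auto
    then show "(-1) ^ card (S - A) = - ((-1) ^ card (S - insert v A) :: int)" using S by simp
  qed
  finally show ?thesis by (simp add: sum_negf)
qed

lemma simple_graphD:
  assumes "simple_graph k E" "{i, j} \<in> E"
  shows "i \<in> {1..k}" "j \<in> {1..k}" "i \<noteq> j"
proof -
  obtain a b where "{i, j} = {a, b}" "1 \<le> a" "a < b" "b \<le> k"
    using assms unfolding simple_graph_def by blast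
  then show "i \<in> {1..k}" "j \<in> {1..k}" "i \<noteq> j"
    by (auto simp: doubleton_eq_iff)
qed

text \<open>Independent sets \<open>A\<close> are grouped by \<open>L = A \<inter> J\<close>. The
  rest \<open>M = A - J\<close> ranges over all subsets of \<open>W L\<close>, and summing over
  \<open>M\<close> gives total weight 1, so the vertices of \<open>W L\<close> leave no factor on
  the left.\<close>

lemma cover_sum_eq_sum_independent:
  fixes x :: "nat \<Rightarrow> 'a :: comm_ring_1"
  assumes G: "simple_graph k E" and J: "vertex_cover k E J"
  shows "(\<Sum>L | L \<subseteq> J \<and> independent_set E L.
            (\<Prod>l\<in>L. x l) * (\<Prod>i\<in>(J - L) \<union> (nbhd_set E L - J). 1 - x i)) =
         (\<Sum>A | A \<subseteq> {1..k} \<and> independent_set E A. (\<Prod>i\<in>A. x i) * (\<Prod>i\<in>{1..k} - A. 1 - x i))"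
proof -
  define W where "W L = {1..k} - J - nbhd_set E L" for L
  have JV: "J \<subseteq> {1..k}" using J by (simp add: vertex_cover_def)
  have finJ: "finite J" using JV finite_subset by blast
  have NV: "nbhd_set E L \<subseteq> {1..k}" for L
    using simple_graphD[OF G] by (auto simp: nbhd_set_def nbhd_def)
  have cov: "i \<in> J \<or> j \<in> J" if "{i, j} \<in> E" for i j
    using J that by (auto simp: vertex_cover_def)
  let ?I = "{L. L \<subseteq> J \<and> independent_set E L}"
  have "(\<Sum>L\<in>?I. (\<Prod>l\<in>L. x l) * (\<Prod>i\<in>(J - L) \<union> (nbhd_set E L - J). 1 - x i)) =
        (\<Sum>L\<in>?I. \<Sum>M\<in>Pow (W L). (\<Prod>i\<in>L \<union> M. x i) * (\<Prod>i\<in>{1..k} - (L \<union> M). 1 - x i))"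
  proof (rule sum.cong[OF refl])
    fix L assume L: "L \<in> ?I"
    let ?C = "(J - L) \<union> (nbhd_set E L - J)"
    have fin: "finite L" "finite ?C" "finite (W L)"
      using L JV NV[of L] by (auto simp: W_def intro: finite_subset)
    have "(\<Sum>M\<in>Pow (W L). (\<Prod>i\<in>L \<union> M. x i) * (\<Prod>i\<in>{1..k} - (L \<union> M). 1 - x i)) =
          (\<Sum>M\<in>Pow (W L). ((\<Prod>l\<in>L. x l) * (\<Prod>i\<in>?C. 1 - x i)) *
                          ((\<Prod>i\<in>M. x i) * (\<Prod>i\<in>W L - M. 1 - x i)))"
    proof (rule sum.cong[OF refl])
      fix M assume M: "M \<in> Pow (W L)"
      have "finite M" using M fin by (auto intro: finite_subset)
      moreover have "L \<inter> M = {}" using M L by (auto simp: W_def)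
      moreover have "{1..k} - (L \<union> M) = ?C \<union> (W L - M)"
        using M L JV NV[of L] by (auto simp: W_def)
      moreover have "?C \<inter> (W L - M) = {}" using L by (auto simp: W_def)
      ultimately show "(\<Prod>i\<in>L \<union> M. x i) * (\<Prod>i\<in>{1..k} - (L \<union> M). 1 - x i) =
          ((\<Prod>l\<in>L. x l) * (\<Prod>i\<in>?C. 1 - x i)) * ((\<Prod>i\<in>M. x i) * (\<Prod>i\<in>W L - M. 1 - x i))"
        using fin by (simp add: prod.union_disjoint mult_ac)
    qed
    \<comment> \<open>The sum over \<open>M\<close> is the expanded form of a product whose factors
      \<open>x i + (1 - x i)\<close> all equal 1.\<close>
    also have "\<dots> = (\<Prod>l\<in>L. x l) * (\<Prod>i\<in>?C. 1 - x i) * (\<Prod>i\<in>W L. x i + (1 - x i))"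
      using fin by (simp only: prod_add sum_distrib_left)
    finally show "(\<Prod>l\<in>L. x l) * (\<Prod>i\<in>?C. 1 - x i) =
        (\<Sum>M\<in>Pow (W L). (\<Prod>i\<in>L \<union> M. x i) * (\<Prod>i\<in>{1..k} - (L \<union> M). 1 - x i))"
      by simp
  qed
  also have "\<dots> = (\<Sum>(L, M)\<in>Sigma ?I (\<lambda>L. Pow (W L)).
                     (\<Prod>i\<in>L \<union> M. x i) * (\<Prod>i\<in>{1..k} - (L \<union> M). 1 - x i))"
    using finJ by (subst sum.Sigma) (auto simp: W_def)
  also have "\<dots> = (\<Sum>A | A \<subseteq> {1..k} \<and> independent_set E A.
                     (\<Prod>i\<in>A. x i) * (\<Prod>i\<in>{1..k} - A. 1 - x i))"
  proof (rule sum.reindex_bij_witness[of _ "\<lambda>A. (A \<inter> J, A - J)" "\<lambda>(L, M). L \<union> M"])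
    fix a assume a: "a \<in> Sigma ?I (\<lambda>L. Pow (W L))"
    obtain L M where [simp]: "a = (L, M)" by force
    have LM: "L \<subseteq> J" "independent_set E L" "M \<inter> J = {}" "M \<inter> nbhd_set E L = {}" "M \<subseteq> {1..k}"
      using a by (auto simp: W_def)
    show "((case a of (L, M) \<Rightarrow> L \<union> M) \<inter> J, (case a of (L, M) \<Rightarrow> L \<union> M) - J) = a"
      using LM by auto
    \<comment> \<open>An edge within \<open>L\<close> contradicts independence, one within
      \<open>M\<close> the cover property, and a mixed one the disjointness of \<open>M\<close> from
      \<open>nbhd_set E L\<close>.\<close>
    have "{i, j} \<notin> E" if "i \<in> L \<union> M" "j \<in> L \<union> M" for i j
    proof
      assume e: "{i, j} \<in> E"
      from that LM(2) e have "\<not> (i \<in> L \<and> j \<in> L)" by (auto simp: independent_set_def)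
      moreover from cov[OF e] LM(3) have "\<not> (i \<in> M \<and> j \<in> M)" by auto
      moreover have "i \<in> nbhd E j" "j \<in> nbhd E i"
        using e by (auto simp: nbhd_def insert_commute)
      with LM(4) have "\<not> (i \<in> M \<and> j \<in> L)" "\<not> (i \<in> L \<and> j \<in> M)"
        by (auto simp: nbhd_set_def)
      ultimately show False using that by blast
    qed
    then show "(case a of (L, M) \<Rightarrow> L \<union> M) \<in> {A. A \<subseteq> {1..k} \<and> independent_set E A}"
      using LM JV by (auto simp: independent_set_def)
    show "(\<Prod>i\<in>(case a of (L, M) \<Rightarrow> L \<union> M). x i) *
          (\<Prod>i\<in>{1..k} - (case a of (L, M) \<Rightarrow> L \<union> M). 1 - x i) =
          (case a of (L, M) \<Rightarrow> (\<Prod>i\<in>L \<union> M. x i) * (\<Prod>i\<in>{1..k} - (L \<union> M). 1 - x i))"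
      by simp
  next
    fix A assume A: "A \<in> {A. A \<subseteq> {1..k} \<and> independent_set E A}"
    show "(A \<inter> J, A - J) \<in> Sigma ?I (\<lambda>L. Pow (W L))"
      using A by (auto simp: W_def independent_set_def nbhd_set_def nbhd_def)
  qed auto
  finally show ?thesis .
qed

subsection \<open>Infinite sums\<close>

lemma has_sum_sum:
  fixes f :: "'i \<Rightarrow> 'a \<Rightarrow> 'b :: topological_comm_monoid_add"
  assumes "\<And>i. i \<in> I \<Longrightarrow> (f i has_sum a i) A"
  shows "((\<lambda>x. \<Sum>i\<in>I. f i x) has_sum (\<Sum>i\<in>I. a i)) A"
  using assms by (induction I rule: infinite_finite_induct) (auto intro: has_sum_add)

text \<open>Induction on \<open>A\<close>: a family on \<open>insert x F\<close> is a pair of a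
  value at \<open>x\<close> and a family on \<open>F\<close>, and absolute summability over pairs
  reduces to iterated sums.\<close>

lemma norm_summable_on_prod_PiE:
  fixes f :: "'a \<Rightarrow> 'b \<Rightarrow> 'c :: {banach, real_normed_field}"
  assumes "finite A" "\<And>x. x \<in> A \<Longrightarrow> (\<lambda>y. norm (f x y)) summable_on B x"
  shows "(\<lambda>g. norm (\<Prod>x\<in>A. f x (g x))) summable_on PiE A B"
  using assms
proof (induction A rule: finite_induct)
  case (insert x F)
  have "(\<lambda>yg. norm (case yg of (y, g) \<Rightarrow> f x y * (\<Prod>x\<in>F. f x (g x)))) summable_on B x \<times> PiE F B"
  proof (rule Infinite_Sum.abs_summable_on_Sigma_iff[THEN iffD2], intro conjI ballI)
    show "(\<lambda>g. norm (case (y, g) of (y, g) \<Rightarrow> f x y * (\<Prod>x\<in>F. f x (g x)))) summable_on PiE F B"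
      if "y \<in> B x" for y
      using insert by (simp add: norm_mult summable_on_cmult_right)
    have "(\<lambda>y. norm (f x y) * (\<Sum>\<^sub>\<infinity>g\<in>PiE F B. norm (\<Prod>x\<in>F. f x (g x)))) summable_on B x"
      using insert by (intro summable_on_cmult_left) auto
    then show "(\<lambda>y. norm (\<Sum>\<^sub>\<infinity>g\<in>PiE F B. norm (case (y, g) of (y, g) \<Rightarrow> f x y * (\<Prod>x\<in>F. f x (g x)))))
        summable_on B x"
      using insert by (simp add: norm_mult infsum_cmult_right' infsum_nonneg)
  qed
  then have "((\<lambda>g. norm (\<Prod>x\<in>insert x F. f x (g x))) \<circ> (\<lambda>(y, g). g(x := y)))
      summable_on B x \<times> PiE F B"
  proof (rule summable_on_cong[THEN iffD1, rotated])
    fix yg assume "yg \<in> B x \<times> PiE F B"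
    have "(\<Prod>z\<in>F. f z (if z = x then a else b z)) = (\<Prod>z\<in>F. f z (b z))" for a b
      using insert by (intro prod.cong) auto
    then show "norm (case yg of (y, g) \<Rightarrow> f x y * (\<Prod>x\<in>F. f x (g x))) =
        ((\<lambda>g. norm (\<Prod>x\<in>insert x F. f x (g x))) \<circ> (\<lambda>(y, g). g(x := y))) yg"
      using insert by (cases yg) simp
  qed
  then show ?case
    unfolding PiE_insert_eq using insert
    by (subst summable_on_reindex) (auto simp: inj_combinator)
qed simp

lemma has_sum_prod_PiE:
  fixes f :: "'a \<Rightarrow> 'b \<Rightarrow> 'c :: {banach, real_normed_field}"
  assumes "finite A" "\<And>x. x \<in> A \<Longrightarrow> (\<lambda>y. norm (f x y)) summable_on B x"
    and "\<And>x. x \<in> A \<Longrightarrow> (f x has_sum s x) (B x)"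
  shows "((\<lambda>g. \<Prod>x\<in>A. f x (g x)) has_sum (\<Prod>x\<in>A. s x)) (PiE A B)"
proof -
  have "(\<Sum>\<^sub>\<infinity>g\<in>PiE A B. \<Prod>x\<in>A. f x (g x)) = (\<Prod>x\<in>A. s x)"
    using assms infsum_prod_PiE_abs[of A f B] by (auto simp: infsumI intro!: prod.cong)
  then show ?thesis
    using abs_summable_summable[OF norm_summable_on_prod_PiE[OF assms(1,2)]]
    by (simp add: has_sum_iff)
qed

text \<open>Dominated convergence where each term becomes constant in \<open>N\<close>. On a finite
  set \<open>F\<close> the terms then agree exactly for large \<open>N\<close>, and outside
  \<open>F\<close> the difference is at most \<open>2 * h\<close>.\<close>

lemma has_sum_dominated_eventually_eq:
  fixes f :: "nat \<Rightarrow> 'a \<Rightarrow> 'b :: banach" and h :: "'a \<Rightarrow> real"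
  assumes f: "\<And>N. (f N has_sum a N) A"
    and a: "a \<longlonglongrightarrow> L"
    and h: "h summable_on A"
    and bound: "\<And>N x. x \<in> A \<Longrightarrow> norm (f N x) \<le> h x"
    and ev: "\<And>x. x \<in> A \<Longrightarrow> eventually (\<lambda>N. f N x = g x) sequentially"
  shows "(g has_sum L) A"
proof -
  have gb: "norm (g x) \<le> h x" if x: "x \<in> A" for x
  proof -
    obtain N where "f N x = g x" using ev[OF x] by (auto simp: eventually_sequentially)
    then show ?thesis using bound[OF x, of N] by simp
  qed
  have gs: "g summable_on A"
    by (rule abs_summable_summable, rule summable_on_comparison_test[OF h]) (use gb in auto)
  have "a \<longlonglongrightarrow> infsum g A"
  proof (rule tendstoI)
    fix e :: real assume e: "e > 0"
    \<comment> \<open>With the tail of \<open>h\<close> at most \<open>e / 3\<close>, the error is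
      at most \<open>2 * e / 3 < e\<close>.\<close>
    obtain F where F: "finite F" "F \<subseteq> A" "dist (sum h F) (infsum h A) \<le> e / 3"
      using infsum_finite_approximation[OF h, of "e / 3"] e by auto
    have hA: "h summable_on (A - F)" using h F
      by (metis Diff_subset summable_on_subset_banach)
    have "infsum h A = sum h F + infsum h (A - F)"
      using infsum_Un_disjoint[of h F "A - F"] F hA by (simp add: Un_absorb1)
    then have tail: "infsum h (A - F) \<le> e / 3" using F(3) by (simp add: dist_real_def)
    have "eventually (\<lambda>N. \<forall>x\<in>F. f N x = g x) sequentially"
      using F ev by (intro eventually_ball_finite) auto
    then show "eventually (\<lambda>N. dist (a N) (infsum g A) < e) sequentially"
    proof eventually_elim
      case (elim N)
      have "((\<lambda>x. f N x - g x) has_sum (a N - infsum g A)) A"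
        using has_sum_add[OF f, of "\<lambda>x. - g x" "- infsum g A" N] has_sum_infsum[OF gs]
        by (simp add: has_sum_uminus)
      then have "((\<lambda>x. f N x - g x) has_sum (a N - infsum g A)) (A - F)"
        using elim F by (subst has_sum_cong_neutral[where T = A]) auto
      moreover have "((\<lambda>x. 2 * h x) has_sum (2 * infsum h (A - F))) (A - F)"
        using has_sum_cmult_right[OF has_sum_infsum[OF hA]] .
      moreover have "norm (f N x - g x) \<le> 2 * h x" if "x \<in> A - F" for x
        using norm_triangle_ineq4[of "f N x" "g x"] bound[of x N] gb[of x] that by simp
      ultimately have "norm (a N - infsum g A) \<le> 2 * infsum h (A - F)"
        by (rule norm_infsum_le)
      then show ?case using tail e by (simp add: dist_norm)
    qed
  qed
  then have "infsum g A = L" using a LIMSEQ_unique by blast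
  then show ?thesis using gs has_sum_infsum by blast
qed

section \<open>Zeta series and their restrictions to multiples\<close>

lemma norm_one_over_nat_powr: "norm (1 / of_nat n powr s :: complex) = real n powr - Re s"
  by (simp add: norm_divide norm_powr_real_powr powr_minus_divide)

lemma of_nat_mult_powr:
  "of_nat (m * n) powr s = of_nat m powr s * of_nat n powr (s :: complex)"
  by (simp add: powr_times_real)

lemma zeta_series:
  assumes "Re s > 1"
  shows "(\<lambda>n. norm (1 / of_nat n powr s :: complex)) summable_on {1..}"
    and "((\<lambda>n. 1 / of_nat n powr s) has_sum zeta s) {1..}"
proof -
  let ?f = "\<lambda>n. 1 / of_nat n powr s :: complex"
  have Suc: "{1..} = Suc ` UNIV" using greaterThan_0 by (auto simp: greaterThan_def)
  have "summable (\<lambda>n. real n powr - Re s)"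
    using assms by (simp add: summable_real_powr_iff)
  then have sm: "summable (\<lambda>n. norm (?f (Suc n)))"
    unfolding norm_one_over_nat_powr by (subst summable_Suc_iff)
  then have "(\<lambda>n. norm (?f (Suc n))) summable_on UNIV"
    using norm_summable_imp_summable_on[of "\<lambda>n. norm (?f (Suc n))"] by simp
  then show "(\<lambda>n. norm (?f n)) summable_on {1..}"
    unfolding Suc by (subst summable_on_reindex) (auto simp: o_def)
  have "((\<lambda>n. ?f (Suc n)) has_sum zeta s) UNIV"
    unfolding zeta_def
    by (intro norm_summable_imp_has_sum sm summable_sums summable_norm_cancel[OF sm])
  then show "(?f has_sum zeta s) {1..}"
    unfolding Suc by (subst has_sum_reindex) (auto simp: o_def)
qed

text \<open>Substituting \<open>d * n\<close> for \<open>n\<close> pulls the factor belonging to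
  \<open>d\<close> out of the zeta series.\<close>

lemma zeta_series_multiples:
  assumes "Re s > 1" "d \<ge> 1"
  shows "((\<lambda>n. of_bool (d dvd n) / of_nat n powr s) has_sum (1 / of_nat d powr s * zeta s)) {1..}"
proof -
  have "((\<lambda>n. 1 / of_nat d powr s * (1 / of_nat n powr s)) has_sum (1 / of_nat d powr s * zeta s)) {1..}"
    by (intro has_sum_cmult_right zeta_series assms)
  also have "(\<lambda>n. 1 / of_nat d powr s * (1 / of_nat n powr s)) =
             (\<lambda>n. of_bool (d dvd n) / of_nat n powr s) \<circ> (\<lambda>n. d * n)"
    by (auto simp: of_nat_mult_powr fun_eq_iff simp del: of_nat_mult)
  finally have "((\<lambda>n. of_bool (d dvd n) / of_nat n powr s) has_sum (1 / of_nat d powr s * zeta s))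
      ((\<lambda>n. d * n) ` {1..})"
    using assms(2) by (subst has_sum_reindex) (auto simp: inj_on_def simp del: o_apply)
  then show ?thesis
    using assms(2) by (subst has_sum_cong_neutral[where T = "(\<lambda>n. d * n) ` {1..}"])
      (auto elim!: dvdE)
qed

lemma multi_zeta_series_multiples:
  assumes "finite V" "\<And>i. i \<in> V \<Longrightarrow> Re (s i) > 1" "\<And>i. i \<in> V \<Longrightarrow> d i \<ge> 1"
  shows "((\<lambda>n. \<Prod>i\<in>V. of_bool (d i dvd n i) / of_nat (n i) powr s i) has_sum
           (\<Prod>i\<in>V. 1 / of_nat (d i) powr s i * zeta (s i))) (PiE V (\<lambda>_. {1..}))"
proof (rule has_sum_prod_PiE[OF assms(1)])
  fix i assume i: "i \<in> V"
  show "((\<lambda>n. of_bool (d i dvd n) / of_nat n powr s i) has_sum (1 / of_nat (d i) powr s i * zeta (s i))) {1..}"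
    using assms i by (intro zeta_series_multiples) auto
  show "(\<lambda>n. norm (of_bool (d i dvd n) / of_nat n powr s i :: complex)) summable_on {1..}"
    by (rule Infinite_Sum.abs_summable_on_comparison_test[OF zeta_series(1)[OF assms(2)[OF i]]])
       (auto simp: norm_divide)
qed

subsection \<open>Euler product\<close>

lemma prod_of_bool:
  assumes "finite Q"
  shows "(\<Prod>q\<in>Q. of_bool (P q)) = (of_bool (\<forall>q\<in>Q. P q) :: 'a :: comm_semiring_1)"
  using assms by (induction Q rule: finite_induct) auto

text \<open>
  The divisibility constraints \<open>d i dvd n i\<close> make the induction on \<open>Q\<close> work: expanding the condition at a
  new prime \<open>q\<close> by \<open>sum_indep_coeff\<close> merely replaces \<open>d i\<close> by \<open>d i * q\<close> for \<open>i \<in> S\<close>.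
\<close>

lemma has_sum_independent_at_primes:
  assumes "finite V" "\<And>i. i \<in> V \<Longrightarrow> Re (s i) > 1"
    and "finite Q" "\<And>q. q \<in> Q \<Longrightarrow> prime q"
    and "\<And>i. i \<in> V \<Longrightarrow> d i \<ge> 1" "\<And>i q. i \<in> V \<Longrightarrow> q \<in> Q \<Longrightarrow> \<not> q dvd d i"
  shows "((\<lambda>n. (\<Prod>q\<in>Q. of_bool (independent_set E {i \<in> V. q dvd n i})) *
              (\<Prod>i\<in>V. of_bool (d i dvd n i) / of_nat (n i) powr s i)) has_sum
           (\<Prod>q\<in>Q. \<Sum>S\<in>Pow V. of_int (indep_coeff E S) * (\<Prod>i\<in>S. 1 / of_nat q powr s i)) *
           (\<Prod>i\<in>V. 1 / of_nat (d i) powr s i * zeta (s i))) (PiE V (\<lambda>_. {1..}))"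
  using assms(3-6)
proof (induction Q arbitrary: d rule: finite_induct)
  case empty
  then show ?case
    using multi_zeta_series_multiples[where V = V and s = s and d = d] assms(1,2) by simp
next
  case (insert q Q)
  define w where "w d n = (\<Prod>i\<in>V. of_bool (d i dvd n i) / of_nat (n i) powr s i)"
    for d n :: "nat \<Rightarrow> nat"
  define D where "D n = (\<Prod>q\<in>Q. of_bool (independent_set E {i \<in> V. q dvd n i}) :: complex)"
    for n :: "nat \<Rightarrow> nat"
  define P where "P = (\<Prod>q\<in>Q. \<Sum>S\<in>Pow V. of_int (indep_coeff E S) * (\<Prod>i\<in>S. 1 / of_nat q powr s i))"
  define Z where "Z d = (\<Prod>i\<in>V. 1 / of_nat (d i) powr s i * zeta (s i))" for d :: "nat \<Rightarrow> nat"
  define dS where "dS S i = d i * (if i \<in> S then q else 1)" for S i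
  have q: "prime q" using insert.prems by simp
  have sub: "((\<lambda>n. D n * w (dS S) n) has_sum (P * Z (dS S))) (PiE V (\<lambda>_. {1..}))" for S
    unfolding D_def w_def P_def Z_def
  proof (rule insert.IH)
    fix i assume i: "i \<in> V"
    show "dS S i \<ge> 1" using insert.prems(2)[OF i] prime_gt_0_nat[OF q] by (simp add: dS_def)
    fix r assume r: "r \<in> Q"
    then have "prime r" "\<not> r dvd d i" using insert.prems i by auto
    \<comment> \<open>Distinct primes do not divide each other, so the non-divisibility hypothesis
      survives the passage from \<open>d\<close> to \<open>dS S\<close>.\<close>
    moreover have "\<not> r dvd q" using primes_dvd_imp_eq[of r q] q \<open>prime r\<close> r insert.hyps by auto
    ultimately show "\<not> r dvd dS S i" by (auto simp: dS_def prime_dvd_mult_iff)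
  qed (use insert.prems in auto)
  have expand: "of_bool (independent_set E {i \<in> V. q dvd n i}) * w d n =
        (\<Sum>S\<in>Pow V. of_int (indep_coeff E S) * w (dS S) n)" for n
  proof -
    let ?A = "{i \<in> V. q dvd n i}"
    have wS: "w (dS S) n = of_bool (S \<subseteq> ?A) * w d n" if S: "S \<subseteq> V" for S
    proof -
      have dv: "d i * q dvd n i \<longleftrightarrow> q dvd n i \<and> d i dvd n i" if "i \<in> V" for i
      proof -
        \<comment> \<open>Coprimality lets divisibility by the product split into the old constraint
          and divisibility by \<open>q\<close>.\<close>
        have "coprime (d i) q"
          using q insert.prems(3)[OF that, of q]
          by (simp add: coprime_commute prime_imp_coprime)
        then show ?thesis by (auto intro: divides_mult dest: dvd_mult_left dvd_mult_right)
      qed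
      have "w (dS S) n = (\<Prod>i\<in>V. of_bool (i \<in> S \<longrightarrow> q dvd n i) *
              (of_bool (d i dvd n i) / of_nat (n i) powr s i))"
        unfolding w_def using dv by (intro prod.cong) (auto simp: dS_def)
      also have "\<dots> = of_bool (\<forall>i\<in>V. i \<in> S \<longrightarrow> q dvd n i) * w d n"
        by (simp only: prod.distrib w_def prod_of_bool[OF assms(1)])
      also have "(\<forall>i\<in>V. i \<in> S \<longrightarrow> q dvd n i) \<longleftrightarrow> S \<subseteq> ?A" using S by auto
      finally show ?thesis .
    qed
    have "of_bool (independent_set E ?A) * w d n = (\<Sum>S\<in>Pow ?A. of_int (indep_coeff E S) * w d n)"
      using assms(1) by (simp add: sum_indep_coeff flip: sum_distrib_right)
    \<comment> \<open>The additional sets \<open>S\<close>, those not contained in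
      \<open>?A\<close>, contribute 0 by \<open>wS\<close>.\<close>
    also have "\<dots> = (\<Sum>S\<in>Pow V. of_int (indep_coeff E S) * w (dS S) n)"
      using assms(1) by (intro sum.mono_neutral_cong_left) (auto simp: wS Collect_mono_iff subset_iff)
    finally show ?thesis .
  qed
  have ZS: "Z (dS S) = (\<Prod>i\<in>S. 1 / of_nat q powr s i) * Z d" if S: "S \<subseteq> V" for S
  proof -
    have "Z (dS S) = (\<Prod>i\<in>V. (if i \<in> S then 1 / of_nat q powr s i else 1) *
                       (1 / of_nat (d i) powr s i * zeta (s i)))"
      unfolding Z_def
      by (intro prod.cong) (auto simp: dS_def of_nat_mult_powr simp del: of_nat_mult)
    also have "\<dots> = (\<Prod>i\<in>V \<inter> S. 1 / of_nat q powr s i) * Z d"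
      using assms(1) by (simp only: prod.distrib Z_def prod.inter_restrict)
    also have "V \<inter> S = S" using S by auto
    finally show ?thesis .
  qed
  have "((\<lambda>n. \<Sum>S\<in>Pow V. of_int (indep_coeff E S) * (D n * w (dS S) n)) has_sum
         (\<Sum>S\<in>Pow V. of_int (indep_coeff E S) * (P * Z (dS S)))) (PiE V (\<lambda>_. {1..}))"
    by (intro has_sum_sum has_sum_cmult_right sub)
  also have "(\<lambda>n. \<Sum>S\<in>Pow V. of_int (indep_coeff E S) * (D n * w (dS S) n)) =
             (\<lambda>n. of_bool (independent_set E {i \<in> V. q dvd n i}) * D n * w d n)"
  proof
    fix n
    have "(\<Sum>S\<in>Pow V. of_int (indep_coeff E S) * (D n * w (dS S) n)) =
          D n * (\<Sum>S\<in>Pow V. of_int (indep_coeff E S) * w (dS S) n)"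
      by (simp add: sum_distrib_left mult_ac)
    then show "(\<Sum>S\<in>Pow V. of_int (indep_coeff E S) * (D n * w (dS S) n)) =
          of_bool (independent_set E {i \<in> V. q dvd n i}) * D n * w d n"
      by (simp only: expand[symmetric] mult_ac)
  qed
  also have "(\<Sum>S\<in>Pow V. of_int (indep_coeff E S) * (P * Z (dS S))) =
      (\<Sum>S\<in>Pow V. of_int (indep_coeff E S) * (\<Prod>i\<in>S. 1 / of_nat q powr s i)) * P * Z d"
    by (simp add: ZS sum_distrib_left sum_distrib_right mult_ac)
  finally show ?case
    by (simp only: prod.insert[OF insert.hyps] D_def w_def P_def Z_def)
qed

text \<open>A gcd other than 1 has a prime factor \<open>q\<close>; since \<open>n i\<close> is
  positive and at most \<open>N\<close>, so is \<open>q\<close>. Hence the truncated condition is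
  already exact.\<close>

lemma delta_eq_prod_primes:
  assumes "simple_graph k E" "n \<in> PiE {1..k} (\<lambda>_. {1..})" "\<And>i. i \<in> {1..k} \<Longrightarrow> n i \<le> N"
  shows "delta E n = (\<Prod>q | prime q \<and> q \<le> N. of_bool (independent_set E {i \<in> {1..k}. q dvd n i}))"
proof -
  have fin: "finite {q. prime q \<and> q \<le> N}" by (rule finite_subset[of _ "{..N}"]) auto
  have "(\<forall>i j. {i, j} \<in> E \<longrightarrow> gcd (n i) (n j) = 1) \<longleftrightarrow>
        (\<forall>q\<in>{q. prime q \<and> q \<le> N}. independent_set E {i \<in> {1..k}. q dvd n i})" (is "?L \<longleftrightarrow> ?R")
  proof
    assume L: ?L
    show ?R
      unfolding independent_set_def
    proof (intro ballI notI)
      fix q i j assume *: "q \<in> {q. prime q \<and> q \<le> N}" "i \<in> {i \<in> {1..k}. q dvd n i}"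
        "j \<in> {i \<in> {1..k}. q dvd n i}" "{i, j} \<in> E"
      then have "q dvd gcd (n i) (n j)" by simp
      then show False using L * by (auto simp: prime_nat_iff)
    qed
  next
    assume R: ?R
    show ?L
    proof (intro allI impI, rule ccontr)
      fix i j assume e: "{i, j} \<in> E" and g: "gcd (n i) (n j) \<noteq> 1"
      obtain q where q: "prime q" "q dvd gcd (n i) (n j)" using prime_factor_nat[OF g] by blast
      have ij: "i \<in> {1..k}" "j \<in> {1..k}" using simple_graphD[OF assms(1) e] by auto
      then have "n i \<ge> 1" using assms(2) by (auto simp: PiE_iff)
      then have "q \<le> N" using q dvd_imp_le[of q "n i"] assms(3)[OF ij(1)] by simp
      then show False using R q ij e by (auto simp: independent_set_def)
    qed
  qed
  then show ?thesis unfolding delta_def prod_of_bool[OF fin] by simp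
qed

section \<open>Expansion of the local factors and convergence of their product\<close>

lemma prod_one_over_powr:
  fixes z :: complex
  assumes "z \<noteq> 0"
  shows "(\<Prod>i\<in>S. 1 / z powr s i) = 1 / z powr (\<Sum>i\<in>S. s i)"
  using assms by (induction S rule: infinite_finite_induct) (auto simp: powr_add)

lemma finite_non_isolated: "finite (non_isolated k E)"
  by (simp add: non_isolated_def)

lemma cover_factor_expansion:
  assumes "simple_graph k E" "vertex_cover k E J"
  shows "cover_factor E J s p =
           (\<Sum>S\<in>Pow {1..k}. of_int (indep_coeff E S) * (\<Prod>i\<in>S. 1 / of_nat p powr s i))"
  unfolding cover_factor_def cover_sum_eq_sum_independent[OF assms]
  by (rule sum_independent_eq_sum_indep_coeff) simp

text \<open>With no linear terms and no isolated vertices left, the deviation from 1 involves only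
  the exponents that the convergence condition controls.\<close>

lemma cover_factor_eq_sum_card_ge_2:
  assumes G: "simple_graph k E" and J: "vertex_cover k E J" and p: "p > 0"
  shows "cover_factor E J s p =
           1 + (\<Sum>S | S \<subseteq> non_isolated k E \<and> 2 \<le> card S.
                  of_int (indep_coeff E S) / of_nat p powr (\<Sum>i\<in>S. s i))"
proof -
  define g where "g S = of_int (indep_coeff E S) / of_nat p powr (\<Sum>i\<in>S. s i)" for S
  let ?B = "{S. S \<subseteq> non_isolated k E \<and> 2 \<le> card S}"
  have fin: "finite ?B" using finite_non_isolated[of k E] by simp
  have "cover_factor E J s p = sum g (Pow {1..k})"
    using p by (simp add: cover_factor_expansion[OF G J] prod_one_over_powr g_def)
  also have "\<dots> = sum g (insert {} ?B)"
  proof (rule sum.mono_neutral_right)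
    show "insert {} ?B \<subseteq> Pow {1..k}" by (auto simp: non_isolated_def)
    show "\<forall>S\<in>Pow {1..k} - insert {} ?B. g S = 0"
    proof
      fix S assume S: "S \<in> Pow {1..k} - insert {} ?B"
      then have fS: "finite S" by (auto intro: finite_subset)
      have "indep_coeff E S = 0"
      proof (cases "S \<subseteq> non_isolated k E")
        case True
        then have "card S = 1" using S fS card_gt_0_iff[of S] by auto
        then obtain i where "S = {i}" by (auto simp: card_1_singleton_iff)
        moreover have "{i} \<notin> E" using simple_graphD(3)[OF G, of i i] by auto
        ultimately show ?thesis by (simp add: indep_coeff_singleton)
      next
        case False
        then obtain v where "v \<in> S" "v \<notin> non_isolated k E" by auto
        then show ?thesis using S fS
          by (intro indep_coeff_isolated[of S v]) (auto simp: non_isolated_def)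
      qed
      then show "g S = 0" by (simp add: g_def)
    qed
  qed simp
  also have "\<dots> = g {} + sum g ?B" using fin by (subst sum.insert) auto
  \<comment> \<open>Positivity matters here, because \<open>0 powr 0 = 0\<close>.\<close>
  also have "g {} = 1" using p by (simp add: g_def indep_coeff_empty)
  finally show ?thesis by (simp add: g_def)
qed

lemma cover_factor_eq_expanded_factor:
  assumes G: "simple_graph k E" and J: "vertex_cover k E J" and p: "p > 0"
  shows "cover_factor E J s p = expanded_factor k E (indep_coeff E) s p"
proof -
  define g where "g S = of_int (indep_coeff E S) / of_nat p powr (\<Sum>i\<in>S. s i)" for S
  define I where "I = non_isolated k E"
  have fI: "finite I" by (simp add: I_def finite_non_isolated)
  let ?B2 = "{S. S \<subseteq> I \<and> 2 \<le> card S}" and ?B3 = "{S. S \<subseteq> I \<and> 3 \<le> card S}"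
  have edge: "\<exists>i j. e = {i, j} \<and> i \<noteq> j \<and> i \<in> I \<and> j \<in> I" if e_in: "e \<in> E" for e
  proof -
    obtain i j where e: "e = {i, j}" using e_in G unfolding simple_graph_def by blast
    then have "{i, j} \<in> E" "{j, i} \<in> E" using e_in by (simp_all add: insert_commute)
    then show ?thesis using simple_graphD[OF G, of i j] e by (auto simp: I_def non_isolated_def)
  qed
  have loop: "{i} \<notin> E" for i using edge[of "{i}"] by auto
  have EB: "e \<subseteq> I \<and> card e = 2" if "e \<in> E" for e using edge[OF that] by auto
  then have finE: "finite E" using fI by (intro finite_subset[of E "Pow I"]) auto
  \<comment> \<open>Among the two-element sets only the edges have a nonzero coefficient.\<close>
  have "sum g ?B2 = sum g (E \<union> ?B3)"
  proof (rule sum.mono_neutral_right)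
    show "\<forall>S\<in>?B2 - (E \<union> ?B3). g S = 0"
    proof
      fix S assume S: "S \<in> ?B2 - (E \<union> ?B3)"
      then have "card S = 2" by auto
      then obtain i j where "S = {i, j}" "i \<noteq> j" by (auto simp: card_2_iff)
      then show "g S = 0" using S by (simp add: g_def indep_coeff_pair[OF loop loop])
    qed
  qed (use fI EB in force)+
  also have "\<dots> = sum g E + sum g ?B3"
    using finE fI EB by (intro sum.union_disjoint) force+
  also have "sum g E = - (\<Sum>e\<in>E. 1 / of_nat p powr (\<Sum>i\<in>e. s i))"
    unfolding sum_negf[symmetric]
  proof (rule sum.cong[OF refl])
    fix e assume e: "e \<in> E"
    obtain i j where "e = {i, j}" "i \<noteq> j" using edge[OF e] by auto
    then have "indep_coeff E e = -1" using e indep_coeff_pair[OF loop loop, of i j] by simp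
    then show "g e = - (1 / of_nat p powr (\<Sum>i\<in>e. s i))" by (simp add: g_def)
  qed
  also have "sum g ?B3 = (\<Sum>j = 3..card I. sum g {S \<in> ?B3. card S = j})"
    using fI by (intro sum.group[symmetric]) (auto intro: card_mono)
  also have "\<dots> = (\<Sum>j = 3..card I. \<Sum>S | S \<subseteq> I \<and> card S = j. g S)"
    by (intro sum.cong) auto
  finally show ?thesis
    unfolding cover_factor_eq_sum_card_ge_2[OF assms] expanded_factor_def
    by (simp add: g_def I_def)
qed

text \<open>The distance of each factor from 1 is bounded by a finite sum of multiples of
  \<open>real n powr - a\<close> with \<open>a > 1\<close>, which is summable even over all
  naturals.\<close>

lemma abs_convergent_cover_factor:
  assumes G: "simple_graph k E" and J: "vertex_cover k E J"
    and s: "\<And>S. S \<subseteq> non_isolated k E \<Longrightarrow> 2 \<le> card S \<Longrightarrow> Re (\<Sum>i\<in>S. s i) > 1"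
  shows "abs_convergent_euler_prod (cover_factor E J s)"
  unfolding abs_convergent_euler_prod_def
proof (rule summable_imp_abs_convergent_prod, rule summable_comparison_test', rule summable_sum)
  let ?B = "{S. S \<subseteq> non_isolated k E \<and> 2 \<le> card S}"
  let ?h = "\<lambda>S n. \<bar>of_int (indep_coeff E S)\<bar> * real n powr - Re (\<Sum>i\<in>S. s i)"
  show "summable (?h S)" if "S \<in> ?B" for S
    using s[of S] that by (intro summable_mult) (simp add: summable_real_powr_iff)
  fix n :: nat assume "n \<ge> 0"
  show "norm (norm ((if prime n then cover_factor E J s n else 1) - 1)) \<le> (\<Sum>S\<in>?B. ?h S n)"
  proof (cases "prime n")
    case True
    then have "n > 0" by (rule prime_gt_0_nat)
    then have "(if prime n then cover_factor E J s n else 1) - 1 =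
        (\<Sum>S\<in>?B. of_int (indep_coeff E S) * (1 / of_nat n powr (\<Sum>i\<in>S. s i)))"
      using True by (simp add: cover_factor_eq_sum_card_ge_2[OF G J])
    also have "norm \<dots> \<le> (\<Sum>S\<in>?B. norm (of_int (indep_coeff E S) * (1 / of_nat n powr (\<Sum>i\<in>S. s i)) :: complex))"
      by (rule norm_sum)
    also have "\<dots> = (\<Sum>S\<in>?B. ?h S n)"
      by (simp only: norm_mult norm_one_over_nat_powr norm_of_int)
    finally show ?thesis by simp
  qed (auto intro: sum_nonneg)
qed

lemma Re_sum_gt_1:
  assumes "finite S" "S \<noteq> {}" "\<And>i. i \<in> S \<Longrightarrow> Re (s i) > 1"
  shows "Re (\<Sum>i\<in>S. s i) > 1"
  using assms
proof (induction S rule: finite_ne_induct)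
  case (insert i S)
  then have "Re (s i) > 1" "Re (\<Sum>i\<in>S. s i) > 1" by auto
  then show ?case using insert.hyps by simp
qed simp

lemma delta_series_has_sum:
  assumes G: "simple_graph k E" and J: "vertex_cover k E J"
    and s: "\<And>i. i \<in> {1..k} \<Longrightarrow> Re (s i) > 1"
  shows "((\<lambda>n. delta E n / (\<Prod>i=1..k. of_nat (n i) powr s i)) has_sum
           (\<Prod>i=1..k. zeta (s i)) * D' E J s) (PiE {1..k} (\<lambda>_. {1..}))"
proof (rule has_sum_dominated_eventually_eq)
  let ?V = "{1..k}"
  let ?Q = "\<lambda>N. {q. prime q \<and> q \<le> (N :: nat)}"
  let ?w = "\<lambda>n. \<Prod>i\<in>?V. 1 / of_nat (n i) powr s i :: complex"
  let ?D = "\<lambda>N n. \<Prod>q\<in>?Q N. of_bool (independent_set E {i \<in> ?V. q dvd n i}) :: complex"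
  let ?P = "\<lambda>p. if prime p then cover_factor E J s p else 1"
  have finQ: "finite (?Q N)" for N by (rule finite_subset[of _ "{..N}"]) auto
  show "((\<lambda>n. ?D N n * ?w n) has_sum (\<Prod>q\<in>?Q N. cover_factor E J s q) * (\<Prod>i\<in>?V. zeta (s i)))
          (PiE ?V (\<lambda>_. {1..}))" for N
    \<comment> \<open>Taking \<open>d = 1\<close> makes all divisibility constraints
      trivial.\<close>
    using has_sum_independent_at_primes[where V = ?V and s = s and Q = "?Q N" and d = "\<lambda>_. 1" and E = E]
      s finQ[of N]
    by (simp add: cover_factor_expansion[OF G J] prime_nat_iff)
  have "abs_convergent_euler_prod (cover_factor E J s)"
  proof (rule abs_convergent_cover_factor[OF G J])
    fix S assume S: "S \<subseteq> non_isolated k E" "2 \<le> card S"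
    then have "S \<subseteq> ?V" by (auto simp: non_isolated_def)
    then show "Re (\<Sum>i\<in>S. s i) > 1"
      using S s by (intro Re_sum_gt_1) (auto intro: finite_subset)
  qed
  then have "(\<lambda>N. \<Prod>p\<le>N. ?P p) \<longlonglongrightarrow> D' E J s"
    unfolding D'_def euler_prod_def abs_convergent_euler_prod_def
    by (intro convergent_prod_LIMSEQ abs_convergent_prod_imp_convergent_prod)
  \<comment> \<open>Non-prime indices contribute 1, so the partial products of
    \<open>euler_prod\<close> are the truncations at \<open>N\<close>.\<close>
  moreover have "(\<Prod>p\<le>N. ?P p) = (\<Prod>q\<in>?Q N. cover_factor E J s q)" for N
    by (rule prod.mono_neutral_cong_right) auto
  ultimately have "(\<lambda>N. (\<Prod>q\<in>?Q N. cover_factor E J s q) * (\<Prod>i\<in>?V. zeta (s i)))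
      \<longlonglongrightarrow> D' E J s * (\<Prod>i\<in>?V. zeta (s i))"
    by (intro tendsto_mult tendsto_const) simp
  then show "(\<lambda>N. (\<Prod>q\<in>?Q N. cover_factor E J s q) * (\<Prod>i\<in>?V. zeta (s i)))
      \<longlonglongrightarrow> (\<Prod>i\<in>?V. zeta (s i)) * D' E J s"
    by (simp add: mult.commute)
  show "(\<lambda>n. norm (?w n)) summable_on PiE ?V (\<lambda>_. {1..})"
    using s by (intro norm_summable_on_prod_PiE[where f = "\<lambda>i n. 1 / of_nat n powr s i"] zeta_series) auto
  show "norm (?D N n * ?w n) \<le> norm (?w n)" for N n
    unfolding prod_of_bool[OF finQ] by simp
  fix n assume n: "n \<in> PiE ?V (\<lambda>_. {1..} :: nat set)"
  show "\<forall>\<^sub>F N in sequentially. ?D N n * ?w n = delta E n / (\<Prod>i=1..k. of_nat (n i) powr s i)"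
    \<comment> \<open>The sum of the \<open>n i\<close> bounds every single one, so one threshold
      for \<open>N\<close> serves all coordinates.\<close>
    using eventually_ge_at_top[of "sum n ?V"]
  proof eventually_elim
    case (elim N)
    have "n i \<le> N" if "i \<in> ?V" for i
      using member_le_sum[of i ?V n] that elim by simp
    then have "delta E n = ?D N n" by (intro delta_eq_prod_primes[OF G n]) auto
    then show ?case by (simp add: prod_dividef)
  qed
qed

theorem theorem5:
  fixes k :: nat and E :: "nat set set" and J :: "nat set"
  assumes "k \<ge> 2"
    and "simple_graph k E"
    and "vertex_cover k E J"
  shows "\<exists>c :: nat set \<Rightarrow> int.
    (\<forall>s :: nat \<Rightarrow> complex. (\<forall>i\<in>{1..k}. Re (s i) > 1) \<longrightarrow>
       ((\<lambda>n. delta E n / (\<Prod>i=1..k. of_nat (n i) powr s i)) has_sum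
          (\<Prod>i=1..k. zeta (s i)) * D' E J s) (PiE {1..k} (\<lambda>_. {1..}))) \<and>
    (\<forall>s :: nat \<Rightarrow> complex. D' E J s = euler_prod (expanded_factor k E c s)) \<and>
    (\<forall>s :: nat \<Rightarrow> complex.
       (\<forall>S. S \<subseteq> non_isolated k E \<and> 2 \<le> card S \<and> card S \<le> card (non_isolated k E) \<longrightarrow>
          Re (\<Sum>i\<in>S. s i) > 1) \<longrightarrow>
       abs_convergent_euler_prod (cover_factor E J s) \<and>
       abs_convergent_euler_prod (expanded_factor k E c s))"
proof (intro exI[of _ "indep_coeff E"] conjI allI impI)
  fix s :: "nat \<Rightarrow> complex"
  \<comment> \<open>The two factors are known to agree for \<open>p > 0\<close>, in particular at
    primes. As the sequences coincide, both the value and the absolute convergence carry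
    over.\<close>
  have eq: "(\<lambda>p. if prime p then cover_factor E J s p else 1) =
            (\<lambda>p. if prime p then expanded_factor k E (indep_coeff E) s p else 1)"
    using cover_factor_eq_expanded_factor[OF assms(2,3)] prime_gt_0_nat by auto
  show "D' E J s = euler_prod (expanded_factor k E (indep_coeff E) s)"
    unfolding D'_def euler_prod_def eq ..
  show "((\<lambda>n. delta E n / (\<Prod>i=1..k. of_nat (n i) powr s i)) has_sum
          (\<Prod>i=1..k. zeta (s i)) * D' E J s) (PiE {1..k} (\<lambda>_. {1..}))"
    if "\<forall>i\<in>{1..k}. Re (s i) > 1"
    using that by (intro delta_series_has_sum assms) auto
  assume *: "\<forall>S. S \<subseteq> non_isolated k E \<and> 2 \<le> card S \<and> card S \<le> card (non_isolated k E) \<longrightarrow>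
          Re (\<Sum>i\<in>S. s i) > 1"
  show "abs_convergent_euler_prod (cover_factor E J s)"
    using * by (intro abs_convergent_cover_factor[OF assms(2,3)])
      (auto intro: card_mono[OF finite_non_isolated])
  then show "abs_convergent_euler_prod (expanded_factor k E (indep_coeff E) s)"
    unfolding abs_convergent_euler_prod_def eq .
qed

end
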